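(* Let $\mathcal R$ be a set of intermediate quantifiers and let $R_i,R_j\in\mathcal R$ be emptyset-free. Let $u,v$ be distinct variables and $U,V$ finite sets of variables. Then for every formula $\psi$ of $IF(\mathcal R)$: (a) $(R_iu/U)(R_jv/V\cup\{u\})\psi\ \equiv_{\{u,v\}}\ (R_jv/V)(R_iu/U\cup\{v\})\psi$; (b) $(\exists v/V)(R_ju/U\cup\{v\})\psi\ \equiv_{\{u,v\}}\ (R_ju/U)(\exists v/V\cup\{u\})\psi$.
   Context: A generalized quantifier of type $(1)$ is a class $Q$ of structures $(M,S)$, $S$ unary, with $Q^M=\{S\subseteq M:(M,S)\in Q\}$; intermediate quantifiers are such quantifiers distinct from $\forall$ and $\exists$ (no monotonicity assumed). $Q$ is emptyset-free if $\emptyset\notin Q^M$ for every structure $M$. Assignments map finite sets of variables to $M$; $s(a/v)$ sends $v$ to $a$. A team $X$ is a set of assignments with common domain $dom(X)$; $s\sim_V s'$ means $s,s'$ agree outside $V$; $F:X\to\wp(M)$ is $V$-uniform if $s\sim_V s'$ implies $F(s)=F(s')$. $X[F/v]=\{s(a/v):s\in X,a\in F(s)\}$, $X[M/v]=\{s(a/v):s\in X,a\in M\}$. Formulas of $IF(\mathcal R)$: atomic $\alpha$, $\neg\alpha$, $\land$, $\lor$, $(\exists w/W)$, $(\forall w/W)$, $(Rw/W)$ for $R\in\mathcal R$. $FV$: variables of $\alpha$ for (negated) atoms; union for $\land,\lor$; $FV((\mathsf Qw/W)\psi)=(FV(\psi)\setminus\{w\})\cup W$. Semantics: atoms/negated atoms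 hold iff every $s\in X$ satisfies them (Tarskian); $\land$ componentwise; $M,X\models\psi\lor\chi$ iff $X=Y\cup Z$ with $M,Y\models\psi$, $M,Z\models\chi$; $M,X\models(\forall w/W)\psi$ iff $M,X[M/w]\models\psi$; $M,X\models(\exists w/W)\psi$ iff $M,X[F/w]\models\psi$ for a $W$-uniform $F:X\to\wp(M)\setminus\{\emptyset\}$; $M,X\models(Rw/W)\psi$ iff $M,X[F/w]\models\psi$ for a $W$-uniform $F:X\to R^M$. $\psi\equiv_Z\chi$ means: $(FV(\psi)\cup FV(\chi))\cap Z=\emptyset$ and, for every structure $M$ and every team $X$ (suitable for both) with $dom(X)\cap Z=\emptyset$, $M,X\models\psi\iff M,X\models\chi$.
   Formalization: It is additionally assumed that neither u nor v belongs to U or V; otherwise u or v is free in one of the formulas and the freshness clause in the definition of the equivalence modulo {u,v} fails, so the claim is false (e.g. U = {u}). *)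

theory Defs
  imports Main
begin

text \<open>
  A quantifier is a class of structures \<open>(M, S)\<close> with \<open>S\<close> unary.  It is represented by its
  trace on the subsets of a universe type \<open>'m\<close>; as \<open>'m\<close> is arbitrary, it can be taken large
  enough to contain (copies of) any given set of structures at once, in particular
  the structures witnessing that a quantifier differs from \<open>\<forall>\<close> and from \<open>\<exists>\<close>.
  Neither monotonicity nor closure under isomorphism is assumed.
\<close>

type_synonym 'm quantifier = "('m set \<times> 'm set) set"

definition generalized_quantifier :: "'m quantifier \<Rightarrow> bool" where
  "generalized_quantifier Q \<longleftrightarrow> (\<forall>(M, S) \<in> Q. M \<noteq> {} \<and> S \<subseteq> M)"

definition local_quantifier :: "'m quantifier \<Rightarrow> 'm set \<Rightarrow> 'm set set" where
  "local_quantifier Q M = {S. S \<subseteq> M \<and> (M, S) \<in> Q}"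

definition forall_quantifier :: "'m quantifier" where
  "forall_quantifier = {(M, S). M \<noteq> {} \<and> S = M}"

definition exists_quantifier :: "'m quantifier" where
  "exists_quantifier = {(M, S). M \<noteq> {} \<and> S \<subseteq> M \<and> S \<noteq> {}}"

definition intermediate_quantifier :: "'m quantifier \<Rightarrow> bool" where
  "intermediate_quantifier Q \<longleftrightarrow>
     generalized_quantifier Q \<and> Q \<noteq> forall_quantifier \<and> Q \<noteq> exists_quantifier"

definition emptyset_free :: "'m quantifier \<Rightarrow> bool" where
  "emptyset_free Q \<longleftrightarrow> (\<forall>M. M \<noteq> {} \<longrightarrow> {} \<notin> local_quantifier Q M)"

text \<open>
  A symbol applied to argument lists of different lengths counts as different symbols, so arities
  need not be declared; constants are function symbols applied to the empty list.
\<close>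

record ('f, 'p, 'm) struct =
  universe :: "'m set"
  fun_interp :: "'f \<Rightarrow> 'm list \<Rightarrow> 'm"
  rel_interp :: "'p \<Rightarrow> 'm list \<Rightarrow> bool"

definition is_structure :: "('f, 'p, 'm) struct \<Rightarrow> bool" where
  "is_structure A \<longleftrightarrow> universe A \<noteq> {} \<and>
     (\<forall>f xs. set xs \<subseteq> universe A \<longrightarrow> fun_interp A f xs \<in> universe A)"

datatype ('v, 'f) fo_term = Var 'v | Fun 'f "('v, 'f) fo_term list"

datatype ('v, 'f, 'p) fo_atom =
    Eq "('v, 'f) fo_term" "('v, 'f) fo_term"
  | Rel 'p "('v, 'f) fo_term list"

primrec term_vars :: "('v, 'f) fo_term \<Rightarrow> 'v set" where
  "term_vars (Var x) = {x}"
| "term_vars (Fun f ts) = \<Union> (set (map term_vars ts))"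

primrec atom_vars :: "('v, 'f, 'p) fo_atom \<Rightarrow> 'v set" where
  "atom_vars (Eq t t') = term_vars t \<union> term_vars t'"
| "atom_vars (Rel p ts) = \<Union> (set (map term_vars ts))"

text \<open>
  An assignment is a partial map with finite domain, and \<open>s(a/v)\<close> is \<open>s(v \<mapsto> a)\<close>.
\<close>

type_synonym ('v, 'm) assignment = "'v \<Rightarrow> 'm option"

text \<open>
  The domain of a team is an explicit parameter, because it is not determined by the empty team.
\<close>

definition is_team :: "'m set \<Rightarrow> 'v set \<Rightarrow> ('v, 'm) assignment set \<Rightarrow> bool" where
  "is_team M D X \<longleftrightarrow> finite D \<and> (\<forall>s \<in> X. dom s = D \<and> ran s \<subseteq> M)"

definition agree_outside ::
    "'v set \<Rightarrow> ('v, 'm) assignment \<Rightarrow> ('v, 'm) assignment \<Rightarrow> bool" where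
  "agree_outside V s s' \<longleftrightarrow> (\<forall>x. x \<notin> V \<longrightarrow> s x = s' x)"

definition uniform ::
    "'v set \<Rightarrow> ('v, 'm) assignment set \<Rightarrow> (('v, 'm) assignment \<Rightarrow> 'm set) \<Rightarrow> bool" where
  "uniform V X F \<longleftrightarrow> (\<forall>s \<in> X. \<forall>s' \<in> X. agree_outside V s s' \<longrightarrow> F s = F s')"

definition supplement ::
    "('v, 'm) assignment set \<Rightarrow> (('v, 'm) assignment \<Rightarrow> 'm set) \<Rightarrow> 'v \<Rightarrow>
     ('v, 'm) assignment set" where
  "supplement X F v = {s(v \<mapsto> a) | s a. s \<in> X \<and> a \<in> F s}"

definition duplicate ::
    "('v, 'm) assignment set \<Rightarrow> 'm set \<Rightarrow> 'v \<Rightarrow> ('v, 'm) assignment set" where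
  "duplicate X M v = {s(v \<mapsto> a) | s a. s \<in> X \<and> a \<in> M}"

primrec eval_term ::
    "('f, 'p, 'm) struct \<Rightarrow> ('v, 'm) assignment \<Rightarrow> ('v, 'f) fo_term \<Rightarrow> 'm" where
  "eval_term A s (Var x) = the (s x)"
| "eval_term A s (Fun f ts) = fun_interp A f (map (eval_term A s) ts)"

primrec sat_atom ::
    "('f, 'p, 'm) struct \<Rightarrow> ('v, 'm) assignment \<Rightarrow> ('v, 'f, 'p) fo_atom \<Rightarrow> bool" where
  "sat_atom A s (Eq t t') \<longleftrightarrow> eval_term A s t = eval_term A s t'"
| "sat_atom A s (Rel p ts) \<longleftrightarrow> rel_interp A p (map (eval_term A s) ts)"

text \<open>
  \<open>Ex w W \<psi>\<close>, \<open>All w W \<psi>\<close> and \<open>Gen R w W \<psi>\<close> stand for \<open>(\<exists>w/W)\<psi>\<close>, \<open>(\<forall>w/W)\<psi>\<close> and \<open>(Rw/W)\<psi>\<close>.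
\<close>

datatype ('v, 'f, 'p, 'm) formula =
    Atom "('v, 'f, 'p) fo_atom"
  | NegAtom "('v, 'f, 'p) fo_atom"
  | Conj "('v, 'f, 'p, 'm) formula" "('v, 'f, 'p, 'm) formula"
  | Disj "('v, 'f, 'p, 'm) formula" "('v, 'f, 'p, 'm) formula"
  | Ex 'v "'v set" "('v, 'f, 'p, 'm) formula"
  | All 'v "'v set" "('v, 'f, 'p, 'm) formula"
  | Gen "'m quantifier" 'v "'v set" "('v, 'f, 'p, 'm) formula"

primrec IF_formula :: "'m quantifier set \<Rightarrow> ('v, 'f, 'p, 'm) formula \<Rightarrow> bool" where
  "IF_formula \<R> (Atom \<alpha>) \<longleftrightarrow> True"
| "IF_formula \<R> (NegAtom \<alpha>) \<longleftrightarrow> True"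
| "IF_formula \<R> (Conj \<psi> \<chi>) \<longleftrightarrow> IF_formula \<R> \<psi> \<and> IF_formula \<R> \<chi>"
| "IF_formula \<R> (Disj \<psi> \<chi>) \<longleftrightarrow> IF_formula \<R> \<psi> \<and> IF_formula \<R> \<chi>"
| "IF_formula \<R> (Ex w W \<psi>) \<longleftrightarrow> finite W \<and> IF_formula \<R> \<psi>"
| "IF_formula \<R> (All w W \<psi>) \<longleftrightarrow> finite W \<and> IF_formula \<R> \<psi>"
| "IF_formula \<R> (Gen R w W \<psi>) \<longleftrightarrow> R \<in> \<R> \<and> finite W \<and> IF_formula \<R> \<psi>"

primrec FV :: "('v, 'f, 'p, 'm) formula \<Rightarrow> 'v set" where
  "FV (Atom \<alpha>) = atom_vars \<alpha>"
| "FV (NegAtom \<alpha>) = atom_vars \<alpha>"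
| "FV (Conj \<psi> \<chi>) = FV \<psi> \<union> FV \<chi>"
| "FV (Disj \<psi> \<chi>) = FV \<psi> \<union> FV \<chi>"
| "FV (Ex w W \<psi>) = (FV \<psi> - {w}) \<union> W"
| "FV (All w W \<psi>) = (FV \<psi> - {w}) \<union> W"
| "FV (Gen R w W \<psi>) = (FV \<psi> - {w}) \<union> W"

primrec sat ::
    "('f, 'p, 'm) struct \<Rightarrow> ('v, 'm) assignment set \<Rightarrow> ('v, 'f, 'p, 'm) formula \<Rightarrow> bool" where
  "sat A X (Atom \<alpha>) \<longleftrightarrow> (\<forall>s \<in> X. sat_atom A s \<alpha>)"
| "sat A X (NegAtom \<alpha>) \<longleftrightarrow> (\<forall>s \<in> X. \<not> sat_atom A s \<alpha>)"
| "sat A X (Conj \<psi> \<chi>) \<longleftrightarrow> sat A X \<psi> \<and> sat A X \<chi>"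
| "sat A X (Disj \<psi> \<chi>) \<longleftrightarrow> (\<exists>Y Z. X = Y \<union> Z \<and> sat A Y \<psi> \<and> sat A Z \<chi>)"
| "sat A X (Ex w W \<psi>) \<longleftrightarrow>
     (\<exists>F. (\<forall>s \<in> X. F s \<in> Pow (universe A) - {{}}) \<and> uniform W X F \<and>
          sat A (supplement X F w) \<psi>)"
| "sat A X (All w W \<psi>) \<longleftrightarrow> sat A (duplicate X (universe A) w) \<psi>"
| "sat A X (Gen R w W \<psi>) \<longleftrightarrow>
     (\<exists>F. (\<forall>s \<in> X. F s \<in> local_quantifier R (universe A)) \<and> uniform W X F \<and>
          sat A (supplement X F w) \<psi>)"

text \<open>
  \<open>equiv_mod Z \<psi> \<chi>\<close> is \<open>\<psi> \<equiv>\<^sub>Z \<chi>\<close>.  A team is suitable for a formula if its domain contains the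
  free variables of that formula.  The freshness of \<open>Z\<close> is part of the notion: as slash sets
  count as free, an instance with a variable of \<open>Z\<close> in an outermost slash set never holds.
\<close>

definition equiv_mod ::
    "'v set \<Rightarrow> ('v, 'f, 'p, 'm) formula \<Rightarrow> ('v, 'f, 'p, 'm) formula \<Rightarrow> bool" where
  "equiv_mod Z \<psi> \<chi> \<longleftrightarrow>
     (FV \<psi> \<union> FV \<chi>) \<inter> Z = {} \<and>
     (\<forall>A D X. is_structure A \<and> is_team (universe A) D X \<and> FV \<psi> \<union> FV \<chi> \<subseteq> D \<and> D \<inter> Z = {} \<longrightarrow>
        (sat A X \<psi> \<longleftrightarrow> sat A X \<chi>))"

end

(*
  The inner slash set hides the outer variable, so the inner choice function is constant along
  the values of the outer one.  As the chosen sets are nonempty, it therefore descends to the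
  original team, and the two choices can be made in either order.
*)
theory Submission
  imports Defs
begin

lemma supplement_supplement:
  "supplement (supplement X F u) G v =
    {s(u \<mapsto> a, v \<mapsto> b) | s a b. s \<in> X \<and> a \<in> F s \<and> b \<in> G (s(u \<mapsto> a))}"
  unfolding supplement_def by blast

text \<open>Sets in \<open>P\<close> being nonempty, each \<open>s\<close> in \<open>X\<close> has
  an extension in the first supplement at which \<open>G\<close> can be read off. Freshness of
  \<open>v\<close> lets \<open>s\<close> be recovered from \<open>s(v \<mapsto> b)\<close>, so
  \<open>F\<close> survives being postponed.\<close>

lemma swap_supplements:
  fixes X :: "('v, 'm) assignment set"
  assumes "u \<noteq> v"
    and fresh: "\<forall>s \<in> X. s v = None"
    and ne: "{} \<notin> P"
    and FP: "\<forall>s \<in> X. F s \<in> P" and FU: "uniform U X F"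
    and GQ: "\<forall>s \<in> supplement X F u. G s \<in> Q"
    and GV: "uniform (V \<union> {u}) (supplement X F u) G"
  obtains G' F' where "\<forall>s \<in> X. G' s \<in> Q" "uniform V X G'"
    and "\<forall>s \<in> supplement X G' v. F' s \<in> P"
    and "uniform (U \<union> {v}) (supplement X G' v) F'"
    and "supplement (supplement X G' v) F' u = supplement (supplement X F u) G v"
proof -
  \<comment> \<open>Any element of \<open>F s\<close> would do as the sample value for
    \<open>u\<close>: \<open>G\<close> cannot distinguish them.\<close>
  define G' where "G' s = G (s(u \<mapsto> (SOME a. a \<in> F s)))" for s
  \<comment> \<open>Erasing \<open>v\<close> returns to the original assignment, where
    \<open>v\<close> was undefined.\<close>
  define F' where "F' t = F (t(v := None))" for t
  have choice: "(SOME a. a \<in> F s) \<in> F s" if "s \<in> X" for s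
    using FP ne that by (metis some_in_eq)
  have mem: "s(u \<mapsto> a) \<in> supplement X F u" if "s \<in> X" "a \<in> F s" for s a
    using that by (auto simp: supplement_def)
  \<comment> \<open>Hiding \<open>u\<close> absorbs the difference between \<open>a\<close> and
    \<open>a'\<close>. The case \<open>s = s'\<close> shows that \<open>G'\<close> does not depend
    on the sample value; the general case gives its \<open>V\<close>-uniformity.\<close>
  have G_upd: "G (s(u \<mapsto> a)) = G (s'(u \<mapsto> a'))"
    if "s \<in> X" "a \<in> F s" "s' \<in> X" "a' \<in> F s'" "agree_outside V s s'" for s s' a a'
  proof -
    have "agree_outside (V \<union> {u}) (s(u \<mapsto> a)) (s'(u \<mapsto> a'))"
      using that(5) by (simp add: agree_outside_def)
    then show ?thesis
      using GV mem[OF that(1,2)] mem[OF that(3,4)] unfolding uniform_def by blast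
  qed
  have G'_eq: "G (s(u \<mapsto> a)) = G' s" if "s \<in> X" "a \<in> F s" for s a
    unfolding G'_def by (rule G_upd) (simp_all add: that choice agree_outside_def)
  have F'_eq: "F' (s(v \<mapsto> b)) = F s" if "s \<in> X" for s b
  proof -
    have "s(v := None) = s" using fresh that by (simp add: fun_upd_idem)
    then show ?thesis by (simp add: F'_def)
  qed
  show thesis
  proof
    show "\<forall>s \<in> X. G' s \<in> Q"
      by (simp add: G'_def GQ mem choice)
    show "uniform V X G'"
      by (simp add: uniform_def G'_def) (metis G_upd choice)
    show "\<forall>s \<in> supplement X G' v. F' s \<in> P"
      using FP F'_eq by (auto simp: supplement_def)
    show "uniform (U \<union> {v}) (supplement X G' v) F'"
      unfolding uniform_def
    proof (intro ballI impI)
      fix t t'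
      assume "t \<in> supplement X G' v" "t' \<in> supplement X G' v"
        and agree: "agree_outside (U \<union> {v}) t t'"
      then obtain s b s' b' where t: "t = s(v \<mapsto> b)" "t' = s'(v \<mapsto> b')" and X: "s \<in> X" "s' \<in> X"
        by (auto simp: supplement_def)
      \<comment> \<open>The hypothesis says nothing at \<open>v\<close>, but there \<open>s\<close>
        and \<open>s'\<close> are both undefined; elsewhere the updates at \<open>v\<close> change
        nothing.\<close>
      have "agree_outside U s s'"
        unfolding agree_outside_def
      proof (intro allI impI)
        fix x assume "x \<notin> U"
        then show "s x = s' x"
          using agree[unfolded t agree_outside_def, rule_format, of x] bspec[OF fresh X(1)] bspec[OF fresh X(2)]
          by (cases "x = v") simp_all
      qed
      then show "F' t = F' t'"
        using FU X F'_eq unfolding t uniform_def by metis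
    qed
    \<comment> \<open>Once each choice depends on \<open>s\<close> alone, both iterated supplements
      range over the same independent pairs \<open>a\<close>, \<open>b\<close>, and updates at
      distinct variables commute.\<close>
    have "supplement (supplement X G' v) F' u =
        {s(v \<mapsto> b, u \<mapsto> a) | s a b. s \<in> X \<and> a \<in> F s \<and> b \<in> G' s}"
      unfolding supplement_supplement by (metis (no_types, lifting) F'_eq)
    also have "\<dots> = {s(u \<mapsto> a, v \<mapsto> b) | s a b. s \<in> X \<and> a \<in> F s \<and> b \<in> G' s}"
      using \<open>u \<noteq> v\<close> by (simp add: fun_upd_twist)
    also have "\<dots> = supplement (supplement X F u) G v"
      unfolding supplement_supplement by (metis (no_types, lifting) G'_eq)
    finally show "supplement (supplement X G' v) F' u = supplement (supplement X F u) G v" .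
  qed
qed

text \<open>The common shape of the clauses for \<open>Ex\<close> and \<open>Gen\<close>, with an
  arbitrary team property in place of the subformula, so that one exchange result serves both
  claims.\<close>

definition choosable ::
    "'m set set \<Rightarrow> 'v \<Rightarrow> 'v set \<Rightarrow> (('v, 'm) assignment set \<Rightarrow> bool) \<Rightarrow>
     ('v, 'm) assignment set \<Rightarrow> bool" where
  "choosable P w W \<Phi> X \<longleftrightarrow>
     (\<exists>F. (\<forall>s \<in> X. F s \<in> P) \<and> uniform W X F \<and> \<Phi> (supplement X F w))"

lemma sat_Ex_choosable:
  "sat A X (Ex w W \<psi>) \<longleftrightarrow> choosable (Pow (universe A) - {{}}) w W (\<lambda>Y. sat A Y \<psi>) X"
  by (simp add: choosable_def)

lemma sat_Gen_choosable:
  "sat A X (Gen R w W \<psi>) \<longleftrightarrow> choosable (local_quantifier R (universe A)) w W (\<lambda>Y. sat A Y \<psi>) X"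
  by (simp add: choosable_def)

lemma choosable_swap_imp:
  assumes "u \<noteq> v" "\<forall>s \<in> X. s v = None" "{} \<notin> P"
    and "choosable P u U (choosable Q v (V \<union> {u}) \<Phi>) X"
  shows "choosable Q v V (choosable P u (U \<union> {v}) \<Phi>) X"
proof -
  obtain F G where FG: "\<forall>s \<in> X. F s \<in> P" "uniform U X F" "\<forall>s \<in> supplement X F u. G s \<in> Q"
      "uniform (V \<union> {u}) (supplement X F u) G" "\<Phi> (supplement (supplement X F u) G v)"
    using assms(4) unfolding choosable_def by blast
  show ?thesis
    by (rule swap_supplements[OF assms(1-3) FG(1-4)]) (use FG(5) in \<open>metis choosable_def\<close>)
qed

text \<open>The converse is the same implication with the two quantifiers interchanged; it uses
  freshness of \<open>u\<close> and nonemptiness of the sets in \<open>Q\<close>.\<close>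

lemma choosable_swap:
  assumes "u \<noteq> v" "\<forall>s \<in> X. s u = None \<and> s v = None" "{} \<notin> P" "{} \<notin> Q"
  shows "choosable P u U (choosable Q v (V \<union> {u}) \<Phi>) X \<longleftrightarrow>
    choosable Q v V (choosable P u (U \<union> {v}) \<Phi>) X"
  using choosable_swap_imp[of u v X P] choosable_swap_imp[of v u X Q] assms by metis

lemma team_undefined:
  assumes "is_team M D X" "D \<inter> {u, v} = {}"
  shows "\<forall>s \<in> X. s u = None \<and> s v = None"
  using assms unfolding is_team_def by blast

lemma emptyset_free_local:
  assumes "emptyset_free R" "is_structure A"
  shows "{} \<notin> local_quantifier R (universe A)"
  using assms by (simp add: emptyset_free_def is_structure_def)

theorem mainTheorem9:
  fixes \<R> :: "'m quantifier set" and Ri Rj :: "'m quantifier"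
    and u v :: 'v and U V :: "'v set"
    and \<psi> :: "('v, 'f, 'p, 'm) formula"
  assumes "\<forall>R \<in> \<R>. intermediate_quantifier R"
    and "Ri \<in> \<R>" and "Rj \<in> \<R>"
    and "emptyset_free Ri" and "emptyset_free Rj"
    and "u \<noteq> v"
    and "finite U" and "finite V"
    and "{u, v} \<inter> (U \<union> V) = {}"
    and "IF_formula \<R> \<psi>"
  shows "equiv_mod {u, v}
           (Gen Ri u U (Gen Rj v (V \<union> {u}) \<psi>))
           (Gen Rj v V (Gen Ri u (U \<union> {v}) \<psi>)) \<and>
         equiv_mod {u, v}
           (Ex v V (Gen Rj u (U \<union> {v}) \<psi>))
           (Gen Rj u U (Ex v (V \<union> {u}) \<psi>))"
proof -
  have "sat A X (Gen Ri u U (Gen Rj v (V \<union> {u}) \<psi>)) \<longleftrightarrow>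
        sat A X (Gen Rj v V (Gen Ri u (U \<union> {v}) \<psi>))"
    and "sat A X (Ex v V (Gen Rj u (U \<union> {v}) \<psi>)) \<longleftrightarrow>
         sat A X (Gen Rj u U (Ex v (V \<union> {u}) \<psi>))"
    if "is_structure A" "is_team (universe A) D X" "D \<inter> {u, v} = {}"
    for A :: "('f, 'p, 'm) struct" and D and X :: "('v, 'm) assignment set"
  proof -
    have undef: "\<forall>s \<in> X. s u = None \<and> s v = None" "\<forall>s \<in> X. s v = None \<and> s u = None"
      using team_undefined[OF that(2,3)] by auto
    have ne: "{} \<notin> local_quantifier Ri (universe A)" "{} \<notin> local_quantifier Rj (universe A)"
      using assms(4,5) that(1) by (simp_all add: emptyset_free_local)
    show "sat A X (Gen Ri u U (Gen Rj v (V \<union> {u}) \<psi>)) \<longleftrightarrow>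
          sat A X (Gen Rj v V (Gen Ri u (U \<union> {v}) \<psi>))"
      unfolding sat_Gen_choosable by (rule choosable_swap[OF assms(6) undef(1) ne])
    \<comment> \<open>Here \<open>v\<close> is the outer variable, so the exchange is applied with
      \<open>u\<close> and \<open>v\<close> interchanged. The existential quantifier chooses from
      the nonempty subsets of the universe, hence never the empty set.\<close>
    show "sat A X (Ex v V (Gen Rj u (U \<union> {v}) \<psi>)) \<longleftrightarrow>
          sat A X (Gen Rj u U (Ex v (V \<union> {u}) \<psi>))"
      unfolding sat_Gen_choosable sat_Ex_choosable
      by (rule choosable_swap[OF assms(6)[symmetric] undef(2) _ ne(2)]) simp
  qed
  \<comment> \<open>Each of \<open>u\<close> and \<open>v\<close> is bound by its own quantifier,
    and the variable added to the inner slash set is bound by the outer one; what remains to check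
    is that \<open>U\<close> and \<open>V\<close> avoid both.\<close>
  moreover have "(FV (Gen Ri u U (Gen Rj v (V \<union> {u}) \<psi>)) \<union>
      FV (Gen Rj v V (Gen Ri u (U \<union> {v}) \<psi>))) \<inter> {u, v} = {}"
    and "(FV (Ex v V (Gen Rj u (U \<union> {v}) \<psi>)) \<union>
      FV (Gen Rj u U (Ex v (V \<union> {u}) \<psi>))) \<inter> {u, v} = {}"
    using assms(9) by auto
  ultimately show ?thesis
    unfolding equiv_mod_def by blast
qed

end
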